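(* Let $\mathbf{c}=(c_1,\ldots,c_n)$ be an integral sequence, $1\le k\le n$, and $w=w_1\cdots w_k\in\{0,1\}^k$. Then the coordinate ring of the affine toric variety $X_{\check{\sigma}_w}$ corresponding to the cone $\sigma_w$ of $\Sigma(k)$ is $$R_{\check{\sigma}_w}=\mathbb{C}[\phi_1,\ldots,\phi_k]\subset\mathbb{C}[z,z^{-1}],\qquad \phi_j:=z^{\upsilon_{j,w_j}}\quad(1\le j\le k).$$
   Context: An integral sequence $\mathbf{c}=(c_1,\ldots,c_n)$ is given by arbitrary integers $c(i,j)$, $1\le i<j\le n$, with $c(i,i):=1$ and $c_k=(c(1,k),\ldots,c(k,k))\in\mathbb{Z}^k$. For $I=\{i_1<\cdots<i_m\}\subset\{1,\ldots,n\}$ let $\mathcal{C}(I)$ be the upper triangular $m\times m$ matrix with $(r,s)$ entry $c(i_r,i_s)$ for $r\le s$ and $0$ otherwise, and let $\mathcal{B}(I)$ be the matrix with $\mathcal{C}(I)^{-1}=-\mathcal{B}(I)$. The Bott number $b(I)$ is the top-right-corner entry of $\mathcal{B}(I)$. Write $\mathcal{B}(\{1,\ldots,n\})=(b(i,j))$; so $b(i,i)=-1$ and $b(i,j)=0$ for $i>j$. $\Sigma(k)$ is the fan in $\mathbb{R}^k$ (lattice $\mathbb{Z}^k$) with ray generators $a_{i,0}:=e_i$ and $a_{i,1}:=(0,\ldots,0,b(i,i),b(i,i+1),\ldots,b(i,k))$, $1\le i\le k$, and with $k$-dimensional cones $\sigma_w=\mathbb{R}_{\ge}a_{1,w_1}+\cdots+\mathbb{R}_{\ge}a_{k,w_k}$,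 $w\in\{0,1\}^k$. The dual cone is $\check{\sigma}_w=\{x\in\mathbb{R}^k:\langle x,y\rangle\ge0\ \forall y\in\sigma_w\}$, and $X_{\check{\sigma}_w}$ is the affine toric variety whose coordinate ring $R_{\check{\sigma}_w}$ is spanned by the monomials $z^m$, $m\in\check{\sigma}_w\cap\mathbb{Z}^k$, in the Laurent polynomial ring $\mathbb{C}[z,z^{-1}]=\mathbb{C}[z_1^{\pm1},\ldots,z_k^{\pm1}]$, where $z^m=z_1^{m_1}\cdots z_k^{m_k}$. For $w\in\{0,1\}^k$ put $\mathbb{O}_i^j=\{l: i<l<j,\ w_l=0\}$ and $\mathbb{I}(j)=\{l:1\le l<j,\ w_l=1\}$, and for $1\le j\le k$ define $$\upsilon_{j,w_j}:=(-1)^{w_j}e_j+\sum_{i\in\mathbb{I}(j)}(-1)^{w_j}\,b(\{i,j\}\cup\mathbb{O}_i^j)\,e_i$$ (the sum being $0$ if $\mathbb{I}(j)=\emptyset$). *)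

theory Defs
  imports
    Complex_Main
    "HOL-Library.FuncSet"
    "HOL-Library.Poly_Mapping"
    "Jordan_Normal_Form.Determinant"
begin

section \<open>Integral sequences and Bott numbers\<close>

text \<open>
  An integral sequence is carried by a function \<open>c\<close> with \<open>c i j\<close> the integer $c(i,j)$; indices
  start at 1, and the values outside $1 \le i \le j \le n$ are irrelevant.
\<close>

definition integral_sequence :: "nat \<Rightarrow> (nat \<Rightarrow> nat \<Rightarrow> int) \<Rightarrow> bool" where
  "integral_sequence n c \<longleftrightarrow> (\<forall>i\<in>{1..n}. c i i = 1)"

text \<open>Matrix positions count from 0, so that $i_{r+1}$ is \<open>sorted_list_of_set I ! r\<close>.\<close>

definition seq_matrix :: "(nat \<Rightarrow> nat \<Rightarrow> int) \<Rightarrow> nat set \<Rightarrow> int mat" where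
  "seq_matrix c I = mat (card I) (card I)
     (\<lambda>(r, s). if r \<le> s then c (sorted_list_of_set I ! r) (sorted_list_of_set I ! s) else 0)"

definition bott_matrix :: "(nat \<Rightarrow> nat \<Rightarrow> int) \<Rightarrow> nat set \<Rightarrow> int mat" where
  "bott_matrix c I = (THE B. B \<in> carrier_mat (card I) (card I)
     \<and> inverts_mat (seq_matrix c I) (- B) \<and> inverts_mat (- B) (seq_matrix c I))"

text \<open>The inverse exists over the integers, so the description above is never vacuous.\<close>

lemma bott_matrix_ex1:
  assumes "integral_sequence n c" "I \<subseteq> {1..n}"
  shows "\<exists>!B. B \<in> carrier_mat (card I) (card I)
     \<and> inverts_mat (seq_matrix c I) (- B) \<and> inverts_mat (- B) (seq_matrix c I)"
proof -
  let ?m = "card I" and ?C = "seq_matrix c I"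
  have fin: "finite I" using assms(2) finite_subset by blast
  have C: "?C \<in> carrier_mat ?m ?m" by (simp add: seq_matrix_def)
  have diag: "?C $$ (r, r) = 1" if "r < ?m" for r
  proof -
    have "sorted_list_of_set I ! r \<in> I"
      using that fin nth_mem[of r "sorted_list_of_set I"] by simp
    then show ?thesis using that assms by (auto simp: seq_matrix_def integral_sequence_def)
  qed
  have "upper_triangular ?C" by (auto simp: seq_matrix_def)
  then have "det ?C = prod_list (diag_mat ?C)" using C by (rule det_upper_triangular)
  also have "diag_mat ?C = map (\<lambda>_. 1) [0..<?m]"
    unfolding diag_mat_def using diag C by (intro map_cong) auto
  finally have det: "det ?C = 1" by (simp add: map_replicate_const)
  note adj = adj_mat[OF C, unfolded det]
  have one: "(1::int) \<cdot>\<^sub>m 1\<^sub>m ?m = 1\<^sub>m ?m" by auto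
  show ?thesis
  proof (rule ex1I[of _ "- adj_mat ?C"], goal_cases)
    case 1
    have "- (- adj_mat ?C) = adj_mat ?C" using adj(1) by simp
    then show ?case using adj C one by (auto simp: inverts_mat_def)
  next
    case (2 B)
    then have B: "B \<in> carrier_mat ?m ?m" and inv: "- B * ?C = 1\<^sub>m ?m"
      by (auto simp: inverts_mat_def)
    have nB: "- B \<in> carrier_mat ?m ?m" using B by simp
    have "- B = - B * (?C * adj_mat ?C)" using adj(2) one nB by simp
    also have "\<dots> = (- B * ?C) * adj_mat ?C"
      using assoc_mult_mat[OF nB C adj(1)] by simp
    also have "\<dots> = adj_mat ?C" using inv adj(1) by simp
    finally have "- (- B) = - adj_mat ?C" by simp
    then show ?case by simp
  qed
qed

definition bott_number :: "(nat \<Rightarrow> nat \<Rightarrow> int) \<Rightarrow> nat set \<Rightarrow> int" where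
  "bott_number c I = bott_matrix c I $$ (0, card I - 1)"

text \<open>The entries $b(i,j)$ of the matrix belonging to the full index set, for $1 \le i, j \le n$.\<close>

definition bott_entry :: "(nat \<Rightarrow> nat \<Rightarrow> int) \<Rightarrow> nat \<Rightarrow> nat \<Rightarrow> nat \<Rightarrow> int" where
  "bott_entry c n i j = bott_matrix c {1..n} $$ (i - 1, j - 1)"


section \<open>The cones of the fan and their duals\<close>

text \<open>
  The lattice $\mathbf{Z}^k$ consists of the finitely supported functions \<open>nat \<Rightarrow>\<^sub>0 int\<close> with support
  in \<open>{1..k}\<close>, and $\mathbf{R}^k$ of the functions \<open>nat \<Rightarrow> real\<close> vanishing outside \<open>{1..k}\<close>.
\<close>

definition lattice_vecs :: "nat \<Rightarrow> (nat \<Rightarrow>\<^sub>0 int) set" where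
  "lattice_vecs k = {m. Poly_Mapping.keys m \<subseteq> {1..k}}"

definition real_vecs :: "nat \<Rightarrow> (nat \<Rightarrow> real) set" where
  "real_vecs k = {x. \<forall>i. i \<notin> {1..k} \<longrightarrow> x i = 0}"

definition real_of_lattice :: "(nat \<Rightarrow>\<^sub>0 int) \<Rightarrow> nat \<Rightarrow> real" where
  "real_of_lattice m = (\<lambda>i. of_int (Poly_Mapping.lookup m i))"

text \<open>\<open>ray c n k i e\<close> is the generator $a_{i,e}$ in $\mathbf{Z}^k$, for $e \in \{0,1\}$.\<close>

definition ray :: "(nat \<Rightarrow> nat \<Rightarrow> int) \<Rightarrow> nat \<Rightarrow> nat \<Rightarrow> nat \<Rightarrow> nat \<Rightarrow> (nat \<Rightarrow>\<^sub>0 int)" where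
  "ray c n k i e =
     (if e = 0 then Poly_Mapping.single i 1
      else (\<Sum>j = i..k. Poly_Mapping.single j (bott_entry c n i j)))"

definition bott_cone :: "(nat \<Rightarrow> nat \<Rightarrow> int) \<Rightarrow> nat \<Rightarrow> nat \<Rightarrow> (nat \<Rightarrow> nat) \<Rightarrow> (nat \<Rightarrow> real) set" where
  "bott_cone c n k w =
     {\<lambda>j. \<Sum>i = 1..k. t i * real_of_lattice (ray c n k i (w i)) j | t. \<forall>i\<in>{1..k}. 0 \<le> t i}"

definition dual_cone :: "nat \<Rightarrow> (nat \<Rightarrow> real) set \<Rightarrow> (nat \<Rightarrow> real) set" where
  "dual_cone k \<sigma> = {x \<in> real_vecs k. \<forall>y\<in>\<sigma>. 0 \<le> (\<Sum>i = 1..k. x i * y i)}"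


section \<open>Laurent polynomials and coordinate rings\<close>

text \<open>
  A Laurent polynomial is a finitely supported family of complex coefficients indexed by exponents;
  the product of \<open>poly_mapping\<close> is convolution. The type allows variables $z_i$ for all \<open>i\<close>, and
  $\mathbf{C}[z_1^{\pm 1},\ldots,z_k^{\pm 1}]$ is cut out by \<open>laurent_ring k\<close>.
\<close>

type_synonym laurent = "(nat \<Rightarrow>\<^sub>0 int) \<Rightarrow>\<^sub>0 complex"

definition laurent_ring :: "nat \<Rightarrow> laurent set" where
  "laurent_ring k = {f. Poly_Mapping.keys f \<subseteq> lattice_vecs k}"

definition laurent_monom :: "(nat \<Rightarrow>\<^sub>0 int) \<Rightarrow> laurent" where
  "laurent_monom m = Poly_Mapping.single m 1"

definition laurent_scale :: "complex \<Rightarrow> laurent \<Rightarrow> laurent" where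
  "laurent_scale a f = Poly_Mapping.map ((*) a) f"

lemma lookup_laurent_scale [simp]:
  "Poly_Mapping.lookup (laurent_scale a f) m = a * Poly_Mapping.lookup f m"
  by (simp add: laurent_scale_def Poly_Mapping.map.rep_eq when_def)

global_interpretation laurent: vector_space laurent_scale
  by unfold_locales (auto simp: poly_mapping_eq_iff fun_eq_iff lookup_add algebra_simps)

text \<open>
  For a cone $\tau$ in $\mathbf{R}^k$, the ring $R_\tau$ spanned by the monomials with exponent
  in $\tau \cap \mathbf{Z}^k$.
\<close>

definition coordinate_ring :: "nat \<Rightarrow> (nat \<Rightarrow> real) set \<Rightarrow> laurent set" where
  "coordinate_ring k \<tau> =
     laurent.span (laurent_monom ` {m \<in> lattice_vecs k. real_of_lattice m \<in> \<tau>})"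

definition is_subalgebra :: "laurent set \<Rightarrow> bool" where
  "is_subalgebra A \<longleftrightarrow> laurent.subspace A \<and> 1 \<in> A \<and> (\<forall>f\<in>A. \<forall>g\<in>A. f * g \<in> A)"

definition generated_subalgebra :: "laurent set \<Rightarrow> laurent set" where
  "generated_subalgebra S = is_subalgebra hull S"


section \<open>The exponents of the generators\<close>

definition zeros_between :: "(nat \<Rightarrow> nat) \<Rightarrow> nat \<Rightarrow> nat \<Rightarrow> nat set" where
  "zeros_between w i j = {l. i < l \<and> l < j \<and> w l = 0}"

definition ones_below :: "(nat \<Rightarrow> nat) \<Rightarrow> nat \<Rightarrow> nat set" where
  "ones_below w j = {l. 1 \<le> l \<and> l < j \<and> w l = 1}"

definition upsilon :: "(nat \<Rightarrow> nat \<Rightarrow> int) \<Rightarrow> (nat \<Rightarrow> nat) \<Rightarrow> nat \<Rightarrow> (nat \<Rightarrow>\<^sub>0 int)" where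
  "upsilon c w j = Poly_Mapping.single j ((- 1) ^ w j) +
     (\<Sum>i\<in>ones_below w j.
        Poly_Mapping.single i ((- 1) ^ w j * bott_number c ({i, j} \<union> zeros_between w i j)))"

end

theory Submission
  imports Defs
begin

text \<open>
  Expanding $\mathcal{C}(I)^{-1}$ expresses its entry at $(i,j)$ as a signed sum over the increasing
  chains from $i$ to $j$ inside $I$. Splitting such a chain at its last interior index $l$ with
  $w_l = 1$ gives the identity which says that $\upsilon_{1,w_1},\ldots,\upsilon_{k,w_k}$ is dual to
  the rays $a_{1,w_1},\ldots,a_{k,w_k}$ of $\sigma_w$. As the rays are triangular with diagonal
  entries $\pm 1$, the lattice points of the dual cone are exactly the nonnegative integral
  combinations of the $\upsilon_{j,w_j}$.
\<close>

section \<open>Chain sums and Bott numbers\<close>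

text \<open>
  The interior indices of the chains are taken from \<open>S\<close>, the end points need not lie in \<open>S\<close>.
\<close>

function chain_sum :: "(nat \<Rightarrow> nat \<Rightarrow> int) \<Rightarrow> nat set \<Rightarrow> nat \<Rightarrow> nat \<Rightarrow> int" where
  "chain_sum c S i j =
     (if i = j then 1 else if j < i then 0
      else - c i j - (\<Sum>l\<in>{i<..<j} \<inter> S. chain_sum c S i l * c l j))"
  by pat_completeness auto
termination by (relation "measure (\<lambda>(c, S, i, j). j)") auto

declare chain_sum.simps [simp del]

lemma chain_sum_diag [simp]: "chain_sum c S i i = 1"
  by (simp add: chain_sum.simps)

lemma chain_sum_below [simp]: "j < i \<Longrightarrow> chain_sum c S i j = 0"
  by (simp add: chain_sum.simps)

lemma chain_sum_rec:
  "i < j \<Longrightarrow> chain_sum c S i j = - c i j - (\<Sum>l\<in>{i<..<j} \<inter> S. chain_sum c S i l * c l j)"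
  by (subst chain_sum.simps) simp

text \<open>Only indices strictly between the end points are ever summed over. This allows fixed
  sets such as \<open>UNIV\<close> or \<open>{l. w l = 0}\<close> to replace the finite index sets
  of Bott numbers.\<close>

lemma chain_sum_cong:
  assumes "{i<..<j} \<inter> S = {i<..<j} \<inter> T"
  shows "chain_sum c S i j = chain_sum c T i j"
  using assms
proof (induction j rule: less_induct)
  case (less j)
  have "chain_sum c S i l = chain_sum c T i l" if "l \<in> {i<..<j}" for l
  proof (rule less.IH)
    show "l < j" using that by simp
    have "{i<..<l} = {i<..<l} \<inter> {i<..<j}" using that by auto
    then show "{i<..<l} \<inter> S = {i<..<l} \<inter> T" using less.prems by (metis Int_assoc)
  qed
  then show ?case
    using less.prems by (cases i j rule: linorder_cases) (auto simp: chain_sum_rec intro!: sum.cong)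
qed

text \<open>Every chain splits at its last interior index outside \<open>T\<close>.\<close>

lemma chain_sum_split:
  assumes "T \<subseteq> S" "i < j"
  shows "chain_sum c S i j = chain_sum c T i j +
           (\<Sum>l\<in>{i<..<j} \<inter> (S - T). chain_sum c S i l * chain_sum c T l j)"
  using assms(2)
proof (induction j rule: less_induct)
  case (less j)
  let ?Z = "{i<..<j} \<inter> T" and ?O = "{i<..<j} \<inter> (S - T)"
  let ?s = "chain_sum c S" and ?t = "chain_sum c T"
  \<comment> \<open>Unfolding \<open>?t l j\<close> exposes the last interior index \<open>m\<close>
    in \<open>T\<close>; after exchanging the sums, the induction hypothesis at \<open>m\<close>
    evaluates the sum over \<open>l\<close>.\<close>
  have "(\<Sum>l\<in>?O. ?s i l * ?t l j) =
      (\<Sum>l\<in>?O. - (?s i l * c l j) - (\<Sum>m\<in>{m\<in>?Z. l < m}. ?s i l * ?t l m * c m j))"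
  proof (rule sum.cong)
    fix l assume l: "l \<in> ?O"
    then have "{l<..<j} \<inter> T = {m\<in>?Z. l < m}" by auto
    then have "?t l j = - c l j - (\<Sum>m\<in>{m\<in>?Z. l < m}. ?t l m * c m j)"
      using l by (simp add: chain_sum_rec)
    then show "?s i l * ?t l j =
        - (?s i l * c l j) - (\<Sum>m\<in>{m\<in>?Z. l < m}. ?s i l * ?t l m * c m j)"
      by (simp only: right_diff_distrib sum_distrib_left mult.assoc mult_minus_right)
  qed simp
  also have "\<dots> = - (\<Sum>l\<in>?O. ?s i l * c l j)
      - (\<Sum>l\<in>?O. \<Sum>m\<in>{m\<in>?Z. l < m}. ?s i l * ?t l m * c m j)"
    by (simp only: sum_subtractf sum_negf)
  also have "(\<Sum>l\<in>?O. \<Sum>m\<in>{m\<in>?Z. l < m}. ?s i l * ?t l m * c m j) =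
      (\<Sum>m\<in>?Z. \<Sum>l\<in>{l\<in>?O. l < m}. ?s i l * ?t l m * c m j)"
    by (rule sum.swap_restrict) auto
  also have "\<dots> = (\<Sum>m\<in>?Z. (?s i m - ?t i m) * c m j)"
  proof (rule sum.cong)
    fix m assume m: "m \<in> ?Z"
    have "{l \<in> ?O. l < m} = {i<..<m} \<inter> (S - T)" using m by auto
    then show "(\<Sum>l\<in>{l\<in>?O. l < m}. ?s i l * ?t l m * c m j) = (?s i m - ?t i m) * c m j"
      using less.IH[of m] m by (simp add: sum_distrib_right)
  qed simp
  \<comment> \<open>The terms \<open>?t i m * c m j\<close> cancel against the recursion for
    \<open>?t i j\<close>, leaving the recursion for \<open>?s i j\<close> with its interior indices
    divided into \<open>?O\<close> and \<open>?Z\<close>.\<close>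
  finally have "?t i j + (\<Sum>l\<in>?O. ?s i l * ?t l j) =
      - c i j - ((\<Sum>l\<in>?O. ?s i l * c l j) + (\<Sum>m\<in>?Z. ?s i m * c m j))"
    unfolding chain_sum_rec[OF less.prems, of c T] left_diff_distrib sum_subtractf by linarith
  also have "(\<Sum>l\<in>?O. ?s i l * c l j) + (\<Sum>m\<in>?Z. ?s i m * c m j) =
      (\<Sum>l\<in>?O \<union> ?Z. ?s i l * c l j)"
    by (rule sum.union_disjoint[symmetric]) auto
  also have "?O \<union> ?Z = {i<..<j} \<inter> S" using assms(1) by blast
  also have "- c i j - (\<Sum>l\<in>{i<..<j} \<inter> S. ?s i l * c l j) = ?s i j"
    by (rule chain_sum_rec[OF less.prems, symmetric])
  finally show ?case by simp
qed

section \<open>Bott matrices and Bott numbers as chain sums\<close>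

text \<open>For \<open>i < j\<close> the recursion for \<open>chain_sum c I i j\<close> is exactly
  the vanishing of this entry of the matrix product: the terms \<open>x = i\<close> and
  \<open>x = j\<close> supply \<open>c i j\<close> and the chain sum itself.\<close>

lemma chain_sum_inverts:
  assumes "finite I" "i \<in> I" "j \<in> I" "c j j = 1"
  shows "(\<Sum>x\<in>I. chain_sum c I i x * (if x \<le> j then c x j else 0)) = (if i = j then 1 else 0)"
proof (cases i j rule: linorder_cases)
  case less
  have "(\<Sum>x\<in>I. chain_sum c I i x * (if x \<le> j then c x j else 0)) =
      (\<Sum>x\<in>insert i (insert j ({i<..<j} \<inter> I)). chain_sum c I i x * c x j)"
    using assms less by (intro sum.mono_neutral_cong_right) (auto intro: ccontr)
  then show ?thesis using less assms by (simp add: chain_sum_rec)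
next
  case equal
  have "(\<Sum>x\<in>I. chain_sum c I i x * (if x \<le> j then c x j else 0)) =
      (\<Sum>x\<in>{i}. chain_sum c I i x * c x j)"
    using assms equal by (intro sum.mono_neutral_cong_right) auto
  then show ?thesis using equal assms by simp
next
  case greater
  then show ?thesis by (auto intro!: sum.neutral)
qed

lemma bott_matrix_entry:
  assumes "integral_sequence n c" "I \<subseteq> {1..n}" "r < card I" "s < card I"
  shows "bott_matrix c I $$ (r, s) =
           - chain_sum c I (sorted_list_of_set I ! r) (sorted_list_of_set I ! s)"
proof -
  let ?m = "card I" and ?C = "seq_matrix c I" and ?B = "bott_matrix c I"
  let ?L = "sorted_list_of_set I"
  define E where "E = mat ?m ?m (\<lambda>(r, s). chain_sum c I (?L ! r) (?L ! s))"
  have fin: "finite I" using assms(2) finite_subset by blast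
  have E: "E \<in> carrier_mat ?m ?m" by (simp add: E_def)
  have C: "?C \<in> carrier_mat ?m ?m" by (simp add: seq_matrix_def)
  have nth: "?L ! p \<in> I" if "p < ?m" for p
    using that fin nth_mem[of p ?L] by simp
  have bij: "bij_betw ((!) ?L) {0..<?m} I"
    by (rule bij_betw_nth) (auto simp: fin)
  have le_iff: "p \<le> q \<longleftrightarrow> ?L ! p \<le> ?L ! q" if "p < ?m" "q < ?m" for p q
    using that sorted_wrt_nth_less[OF strict_sorted_list_of_set[of I], of p q]
      sorted_wrt_nth_less[OF strict_sorted_list_of_set[of I], of q p]
    by (cases p q rule: linorder_cases) auto
  have EC: "E * ?C = 1\<^sub>m ?m"
  proof (rule eq_matI)
    fix p q assume "p < dim_row (1\<^sub>m ?m :: int mat)" "q < dim_col (1\<^sub>m ?m :: int mat)"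
    then have pq: "p < ?m" "q < ?m" by auto
    let ?f = "\<lambda>x. chain_sum c I (?L ! p) x * (if x \<le> ?L ! q then c x (?L ! q) else 0)"
    have "(E * ?C) $$ (p, q) = (\<Sum>t = 0..<?m. ?f (?L ! t))"
      using pq by (auto simp: E_def seq_matrix_def scalar_prod_def le_iff intro!: sum.cong)
    also have "\<dots> = (\<Sum>x\<in>I. ?f x)"
      by (rule sum.reindex_bij_betw[OF bij])
    also have "\<dots> = (if ?L ! p = ?L ! q then 1 else 0)"
      using nth[OF pq(1)] nth[OF pq(2)] assms(1,2) fin
      by (intro chain_sum_inverts) (auto simp: integral_sequence_def)
    also have "\<dots> = 1\<^sub>m ?m $$ (p, q)"
      using pq le_iff[of p q] le_iff[of q p] by auto
    finally show "(E * ?C) $$ (p, q) = 1\<^sub>m ?m $$ (p, q)" .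
  qed (auto simp: E_def seq_matrix_def)
  have "?B \<in> carrier_mat ?m ?m \<and> inverts_mat ?C (- ?B) \<and> inverts_mat (- ?B) ?C"
    unfolding bott_matrix_def by (rule theI'[OF bott_matrix_ex1[OF assms(1,2)]])
  then have B: "?B \<in> carrier_mat ?m ?m" and CB: "?C * - ?B = 1\<^sub>m ?m"
    using C by (auto simp: inverts_mat_def)
  \<comment> \<open>A left inverse \<open>E\<close> and a right inverse \<open>- ?B\<close> of the
    same matrix coincide.\<close>
  have "E = E * (?C * - ?B)" using E CB by simp
  also have "\<dots> = (E * ?C) * - ?B" using assoc_mult_mat[OF E C, of "- ?B" ?m] B by simp
  also have "\<dots> = - ?B" using EC B by simp
  finally have "E $$ (r, s) = (- ?B) $$ (r, s)" by simp
  then show ?thesis using assms(3,4) B by (simp add: E_def)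
qed

text \<open>The top right corner of the matrix belongs to the first and the last entry of the sorted
  index list.\<close>

lemma bott_number_eq_chain_sum:
  assumes "integral_sequence n c" "I \<subseteq> {1..n}" "I \<noteq> {}"
  shows "bott_number c I = - chain_sum c I (Min I) (Max I)"
proof -
  let ?L = "sorted_list_of_set I"
  have fin: "finite I" using assms(2) finite_subset by blast
  have pos: "0 < card I" using fin assms(3) by (simp add: card_gt_0_iff)
  have hd: "?L ! 0 = Min I"
    using fin assms(3) by (simp add: sorted_list_of_set_nonempty)
  have "?L ! (card I - 1) = Max I"
  proof (rule Max_eqI[symmetric])
    show "?L ! (card I - 1) \<in> I" using nth_mem[of "card I - 1" ?L] fin pos by simp
  next
    fix x assume "x \<in> I"
    then obtain p where "p < card I" "x = ?L ! p"
      using fin by (metis in_set_conv_nth length_sorted_list_of_set set_sorted_list_of_set)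
    then show "x \<le> ?L ! (card I - 1)"
      using fin by (auto intro!: sorted_nth_mono)
  qed (rule fin)
  then show ?thesis
    using bott_matrix_entry[OF assms(1,2), of 0 "card I - 1"] pos hd by (simp add: bott_number_def)
qed

lemma bott_entry_eq_chain_sum:
  assumes "integral_sequence n c" "i \<in> {1..n}" "j \<in> {1..n}"
  shows "bott_entry c n i j = - chain_sum c UNIV i j"
proof -
  \<comment> \<open>Matrix positions start at 0 but indices at 1; the truncated subtraction is
    harmless since \<open>p\<close> is positive.\<close>
  have L: "sorted_list_of_set {1..n} ! (p - 1) = p" if "p \<in> {1..n}" for p
    using that by (simp add: atLeastAtMost_upt del: upt_Suc)
  have "bott_entry c n i j = - chain_sum c {1..n} i j"
    using bott_matrix_entry[OF assms(1) order.refl, of "i - 1" "j - 1"] L assms(2,3)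
    by (auto simp: bott_entry_def)
  also have "chain_sum c {1..n} i j = chain_sum c UNIV i j"
    using assms(2,3) by (intro chain_sum_cong) auto
  finally show ?thesis .
qed

text \<open>The elements of the index set strictly between \<open>i\<close> and \<open>j\<close> are
  exactly the zeros of \<open>w\<close> there. The set of interior indices thereby no longer depends
  on \<open>i\<close> and \<open>j\<close>, as \<open>chain_sum_split\<close> needs.\<close>

lemma bott_number_zeros_between:
  assumes "integral_sequence n c" "1 \<le> i" "i < j" "j \<le> n"
  shows "bott_number c ({i, j} \<union> zeros_between w i j) = - chain_sum c {l. w l = 0} i j"
proof -
  let ?I = "{i, j} \<union> zeros_between w i j"
  have sub: "?I \<subseteq> {1..n}" using assms by (auto simp: zeros_between_def)
  then have fin: "finite ?I" using finite_subset by blast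
  have "Min ?I = i" "Max ?I = j"
    using assms fin by (intro Min_eqI Max_eqI; force simp: zeros_between_def)+
  moreover have "chain_sum c ?I i j = chain_sum c {l. w l = 0} i j"
    by (rule chain_sum_cong) (auto simp: zeros_between_def)
  ultimately show ?thesis using bott_number_eq_chain_sum[OF assms(1) sub] by simp
qed


section \<open>Duality of the exponents and the rays\<close>

text \<open>Kept over the integers, so that its values can serve as multiplicities; real numbers
  enter only through the dual cone itself.\<close>

definition pairing :: "nat \<Rightarrow> (nat \<Rightarrow>\<^sub>0 int) \<Rightarrow> (nat \<Rightarrow>\<^sub>0 int) \<Rightarrow> int" where
  "pairing k m a = (\<Sum>i = 1..k. Poly_Mapping.lookup m i * Poly_Mapping.lookup a i)"

lemma pairing_add: "pairing k (m + m') a = pairing k m a + pairing k m' a"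
  by (simp add: pairing_def lookup_add distrib_right sum.distrib)

lemma pairing_diff: "pairing k (m - m') a = pairing k m a - pairing k m' a"
  by (simp add: pairing_def lookup_minus left_diff_distrib sum_subtractf)

lemma pairing_0 [simp]: "pairing k 0 a = 0"
  by (simp add: pairing_def)

lemma pairing_sum: "pairing k (sum f A) a = (\<Sum>x\<in>A. pairing k (f x) a)"
  by (induction A rule: infinite_finite_induct) (auto simp: pairing_add)

lemma lattice_vecs_0 [simp]: "0 \<in> lattice_vecs k"
  by (simp add: lattice_vecs_def)

lemma lattice_vecs_add: "m \<in> lattice_vecs k \<Longrightarrow> m' \<in> lattice_vecs k \<Longrightarrow> m + m' \<in> lattice_vecs k"
  using keys_add[of m m'] by (auto simp: lattice_vecs_def)

lemma lattice_vecs_diff: "m \<in> lattice_vecs k \<Longrightarrow> m' \<in> lattice_vecs k \<Longrightarrow> m - m' \<in> lattice_vecs k"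
  using keys_diff[of m m'] by (auto simp: lattice_vecs_def)

lemma lattice_vecs_sum:
  "(\<And>x. x \<in> A \<Longrightarrow> f x \<in> lattice_vecs k) \<Longrightarrow> sum f A \<in> lattice_vecs k"
  by (induction A rule: infinite_finite_induct) (auto intro: lattice_vecs_add)

lemma lattice_vecs_single: "i \<in> {1..k} \<Longrightarrow> Poly_Mapping.single i a \<in> lattice_vecs k"
  by (auto simp: lattice_vecs_def)

lemma lookup_ray:
  "Poly_Mapping.lookup (ray c n k i e) j =
     (if e = 0 then (if i = j then 1 else 0) else if j \<in> {i..k} then bott_entry c n i j else 0)"
  by (auto simp: ray_def lookup_sum lookup_single when_def if_distrib cong: if_cong)

lemma lookup_upsilon:
  "Poly_Mapping.lookup (upsilon c w j) i =
     (if i = j then (-1) ^ w j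
      else if i \<in> ones_below w j then (-1) ^ w j * bott_number c ({i, j} \<union> zeros_between w i j)
      else 0)"
proof -
  have "finite (ones_below w j)"
    by (rule finite_subset[of _ "{..<j}"]) (auto simp: ones_below_def)
  moreover have "j \<notin> ones_below w j" by (simp add: ones_below_def)
  ultimately show ?thesis
    by (auto simp: upsilon_def lookup_add lookup_sum lookup_single when_def sum.delta)
qed

lemma upsilon_in_lattice_vecs: "j \<in> {1..k} \<Longrightarrow> upsilon c w j \<in> lattice_vecs k"
  unfolding upsilon_def
  by (intro lattice_vecs_add lattice_vecs_sum lattice_vecs_single) (auto simp: ones_below_def)

text \<open>For \<open>w i = 0\<close> the ray is a unit vector, and \<open>upsilon c w j\<close>
  has no nonzero coordinate at a zero of \<open>w\<close> other than \<open>j\<close>. For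
  \<open>w i = 1\<close> and \<open>i < j\<close> the pairing vanishes by
  \<open>chain_sum_split\<close> with \<open>S = UNIV\<close> and
  \<open>T = {l. w l = 0}\<close>.\<close>

lemma pairing_upsilon_ray:
  assumes "integral_sequence n c" "k \<le> n" "w \<in> {1..k} \<rightarrow> {0, 1}" "i \<in> {1..k}" "j \<in> {1..k}"
  shows "pairing k (upsilon c w j) (ray c n k i (w i)) = (if i = j then 1 else 0)"
proof -
  have w01: "w l = 0 \<or> w l = 1" if "l \<in> {1..k}" for l
    using assms(3) that by auto
  let ?s = "chain_sum c UNIV" and ?t = "chain_sum c {l. w l = 0}"
  define u where "u l = Poly_Mapping.lookup (upsilon c w j) l" for l
  have u_diag: "u j = (-1) ^ w j" by (simp add: u_def lookup_upsilon)
  have u_one: "u l = - ((-1) ^ w j * ?t l j)" if "1 \<le> l" "l < j" "w l = 1" for l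
    using that assms bott_number_zeros_between[of n c l j w]
    by (auto simp: u_def lookup_upsilon ones_below_def)
  have u_zero: "u l = 0" if "l \<noteq> j" "\<not> (1 \<le> l \<and> l < j \<and> w l = 1)" for l
    using that by (auto simp: u_def lookup_upsilon ones_below_def)
  show ?thesis
  proof (cases "w i = 0")
    case True
    then have "pairing k (upsilon c w j) (ray c n k i (w i)) = (\<Sum>l\<in>{i}. u l)"
      unfolding pairing_def using assms(4)
      by (intro sum.mono_neutral_cong_right) (auto simp: lookup_ray u_def)
    then show ?thesis using True u_diag u_zero[of i] by auto
  next
    case False
    then have wi: "w i = 1" using w01[OF assms(4)] by simp
    have "pairing k (upsilon c w j) (ray c n k i (w i)) = (\<Sum>l = i..k. u l * - ?s i l)"
      unfolding pairing_def using assms(1,2,4) wi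
      by (intro sum.mono_neutral_cong_right)
        (auto simp: lookup_ray u_def bott_entry_eq_chain_sum)
    also have "\<dots> = (if i = j then 1 else 0)"
    proof (cases i j rule: linorder_cases)
      case less
      let ?O = "{i<..<j} \<inter> {l. w l = 1}"
      have "(\<Sum>l = i..k. u l * - ?s i l) = (\<Sum>l\<in>insert i (insert j ?O). u l * - ?s i l)"
        using less assms(4,5) u_zero by (intro sum.mono_neutral_right) auto
      also have "\<dots> = u i * - ?s i i + (u j * - ?s i j + (\<Sum>l\<in>?O. u l * - ?s i l))"
        using less by simp
      also have "(\<Sum>l\<in>?O. u l * - ?s i l) = (\<Sum>l\<in>?O. (-1) ^ w j * (?s i l * ?t l j))"
        using assms(4) by (intro sum.cong) (auto simp: u_one)
      also have "\<dots> = (-1) ^ w j * (\<Sum>l\<in>?O. ?s i l * ?t l j)"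
        by (simp add: sum_distrib_left)
      \<comment> \<open>The values of \<open>w\<close> are restricted to 0 and 1 only on
        \<open>{1..k}\<close>, which contains the interval.\<close>
      also have "?O = {i<..<j} \<inter> (UNIV - {l. w l = 0})" (is "_ = ?O'")
      proof -
        have "w l = 1 \<longleftrightarrow> w l \<noteq> 0" if "l \<in> {i<..<j}" for l
          using w01[of l] that assms(4,5) by auto
        then show ?thesis by blast
      qed
      also have "(\<Sum>l\<in>?O'. ?s i l * ?t l j) = ?s i j - ?t i j"
        using chain_sum_split[of "{l. w l = 0}" UNIV i j c] less by simp
      finally show ?thesis
        using less assms(4) wi by (simp add: u_diag u_one algebra_simps)
    next
      case equal
      have "(\<Sum>l = i..k. u l * - ?s i l) = (\<Sum>l\<in>{i}. u l * - ?s i l)"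
        using equal assms(4) u_zero by (intro sum.mono_neutral_right) auto
      then show ?thesis using equal wi u_diag by simp
    next
      case greater
      then show ?thesis using u_zero by (auto intro!: sum.neutral)
    qed
    finally show ?thesis .
  qed
qed

section \<open>Lattice points of the dual cone\<close>

text \<open>The rays form a triangular system: \<open>m\<close> has no nonzero coordinate above its
  largest one \<open>p\<close>, and the ray at \<open>p\<close> has none below \<open>p\<close>, so
  their pairing is a single product whose ray factor is 1 or -1.\<close>

lemma lattice_vec_eq_0I:
  assumes "integral_sequence n c" "k \<le> n" "m \<in> lattice_vecs k"
    and "\<And>i. i \<in> {1..k} \<Longrightarrow> pairing k m (ray c n k i (w i)) = 0"
  shows "m = 0"
proof (rule ccontr)
  assume "m \<noteq> 0"
  define p where "p = Max (Poly_Mapping.keys m)"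
  have p: "p \<in> Poly_Mapping.keys m" using \<open>m \<noteq> 0\<close> by (simp add: p_def)
  then have pk: "p \<in> {1..k}" using assms(3) by (auto simp: lattice_vecs_def)
  have above: "Poly_Mapping.lookup m l = 0" if "p < l" for l
    using that Max_ge[OF finite_keys, of l m] leD by (fastforce simp: p_def in_keys_iff)
  have "pairing k m (ray c n k p (w p)) =
      (\<Sum>l\<in>{p}. Poly_Mapping.lookup m l * Poly_Mapping.lookup (ray c n k p (w p)) l)"
    unfolding pairing_def
  proof (intro sum.mono_neutral_right ballI)
    fix l assume "l \<in> {1..k} - {p}"
    then show "Poly_Mapping.lookup m l * Poly_Mapping.lookup (ray c n k p (w p)) l = 0"
      using above by (cases l p rule: linorder_cases) (auto simp: lookup_ray)
  qed (use pk in auto)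
  moreover have "Poly_Mapping.lookup (ray c n k p (w p)) p \<noteq> 0"
    using pk assms(1,2) by (auto simp: lookup_ray bott_entry_eq_chain_sum)
  ultimately show False using assms(4)[OF pk] p by (auto simp: in_keys_iff)
qed

text \<open>The pairing of \<open>m\<close> with a combination of rays is the same combination of
  its pairings with the rays, so nonnegativity needs checking on the generators only.\<close>

lemma real_of_lattice_in_dual_cone_iff:
  assumes "m \<in> lattice_vecs k"
  shows "real_of_lattice m \<in> dual_cone k (bott_cone c n k w) \<longleftrightarrow>
           (\<forall>i\<in>{1..k}. 0 \<le> pairing k m (ray c n k i (w i)))"
proof -
  let ?a = "\<lambda>i. real_of_lattice (ray c n k i (w i))"
  have real: "real_of_lattice m \<in> real_vecs k"
    using assms by (auto simp: real_vecs_def real_of_lattice_def lattice_vecs_def in_keys_iff)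
  have swap: "(\<Sum>j = 1..k. real_of_lattice m j * (\<Sum>i = 1..k. t i * ?a i j)) =
      (\<Sum>i = 1..k. t i * of_int (pairing k m (ray c n k i (w i))))" for t
    unfolding sum_distrib_left pairing_def of_int_sum
    by (subst sum.swap) (simp add: real_of_lattice_def algebra_simps)
  have "real_of_lattice m \<in> dual_cone k (bott_cone c n k w) \<longleftrightarrow>
      (\<forall>t. (\<forall>i\<in>{1..k}. 0 \<le> t i) \<longrightarrow>
         0 \<le> (\<Sum>i = 1..k. t i * real_of_int (pairing k m (ray c n k i (w i)))))"
    using real unfolding dual_cone_def bott_cone_def swap[symmetric] by auto
  also have "\<dots> \<longleftrightarrow> (\<forall>i\<in>{1..k}. 0 \<le> pairing k m (ray c n k i (w i)))"
  proof (intro iffI allI impI ballI)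
    fix i assume nonneg: "\<forall>t. (\<forall>i\<in>{1..k}. 0 \<le> t i) \<longrightarrow>
         0 \<le> (\<Sum>i = 1..k. t i * real_of_int (pairing k m (ray c n k i (w i))))"
      and i: "i \<in> {1..k}"
    \<comment> \<open>Taking the indicator function of \<open>i\<close> as coefficients singles out
      the ray at \<open>i\<close>.\<close>
    show "0 \<le> pairing k m (ray c n k i (w i))"
      using spec[OF nonneg, of "\<lambda>l. if l = i then 1 else 0"] i
      by (simp add: if_distrib[of "\<lambda>x. x * _"] cong: if_cong)
  qed (auto intro!: sum_nonneg)
  finally show ?thesis .
qed


section \<open>Algebras spanned by monomials\<close>

lemma laurent_scale_mult_left: "laurent_scale a f * g = laurent_scale a (f * g)"
  unfolding laurent_scale_def mult_map_scale_conv_mult by (rule mult.assoc)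

lemma laurent_scale_mult_right: "f * laurent_scale a g = laurent_scale a (f * g)"
  using laurent_scale_mult_left[of a g f] by (simp add: mult.commute)

lemma laurent_monom_add: "laurent_monom (m + m') = laurent_monom m * laurent_monom m'"
  by (simp add: laurent_monom_def mult_single)

lemma laurent_monom_0: "laurent_monom 0 = 1"
  by (simp add: laurent_monom_def)

text \<open>Multiplying monomials adds exponents, so the spanning set is closed under products;
  bilinearity extends this to the span, one factor at a time.\<close>

lemma is_subalgebra_span_monoms:
  assumes "0 \<in> M" "\<And>m m'. m \<in> M \<Longrightarrow> m' \<in> M \<Longrightarrow> m + m' \<in> M"
  shows "is_subalgebra (laurent.span (laurent_monom ` M))"
  unfolding is_subalgebra_def
proof (intro conjI ballI)
  let ?V = "laurent.span (laurent_monom ` M)"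
  show "1 \<in> ?V"
    using assms(1) laurent_monom_0 by (metis imageI laurent.span_base)
  fix f g assume f: "f \<in> ?V" and g: "g \<in> ?V"
  have "laurent_monom m * g \<in> ?V" if "m \<in> M" for m
    using g
  proof (induction rule: laurent.span_induct_alt)
    case (step a x y)
    then obtain m' where "m' \<in> M" "x = laurent_monom m'" by auto
    then have "laurent_monom m * x \<in> ?V"
      using assms(2) that by (auto simp flip: laurent_monom_add intro: laurent.span_base)
    then show ?case using step
      by (simp add: distrib_left laurent_scale_mult_right laurent.span_add laurent.span_scale)
  qed (simp add: laurent.span_zero)
  note monom = this
  show "f * g \<in> ?V"
    using f
  proof (induction rule: laurent.span_induct_alt)
    case (step a x y)
    then have "x * g \<in> ?V" using monom by auto
    then show ?case using step
      by (simp add: distrib_right laurent_scale_mult_left laurent.span_add laurent.span_scale)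
  qed (simp add: laurent.span_zero)
qed (rule laurent.subspace_span)

text \<open>Intersections of subalgebras are subalgebras, hence so is the hull.\<close>

lemma is_subalgebra_generated: "is_subalgebra (generated_subalgebra S)"
  unfolding generated_subalgebra_def
proof (rule hull_in)
  fix T assume "\<forall>A\<in>T. is_subalgebra A"
  then show "is_subalgebra (\<Inter> T)"
    using laurent.subspace_Inter[of T] by (auto simp: is_subalgebra_def)
qed

text \<open>Nonnegative multiples are written as repeated sums, so that each summand of the exponent
  turns into one factor from \<open>A\<close>. For infinite \<open>J\<close> the sum defaults to 0
  and the monomial to 1.\<close>

lemma laurent_monom_sum_nat_in_subalgebra:
  assumes "is_subalgebra A" "\<And>x. x \<in> J \<Longrightarrow> laurent_monom (v x) \<in> A"
  shows "laurent_monom (\<Sum>x\<in>J. (\<Sum>_<(d x :: nat). v x)) \<in> A"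
proof -
  have "laurent_monom (\<Sum>_<(d x :: nat). v x) \<in> A" if "x \<in> J" for x
  proof -
    have "laurent_monom (\<Sum>_<(p :: nat). v x) \<in> A" for p
      using assms that
      by (induction p)
        (auto simp: laurent_monom_add laurent_monom_0 is_subalgebra_def simp del: sum_constant)
    then show ?thesis .
  qed
  then show ?thesis
    using assms(1)
    by (induction J rule: infinite_finite_induct)
      (auto simp: laurent_monom_add laurent_monom_0 is_subalgebra_def simp del: sum_constant)
qed


theorem corollary3p36:
  fixes c :: "nat \<Rightarrow> nat \<Rightarrow> int" and n k :: nat and w :: "nat \<Rightarrow> nat"
  assumes "integral_sequence n c"
    and "1 \<le> k" and "k \<le> n"
    and "w \<in> {1..k} \<rightarrow> {0, 1}"
  shows "coordinate_ring k (dual_cone k (bott_cone c n k w)) =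
           generated_subalgebra {laurent_monom (upsilon c w j) | j. j \<in> {1..k}} \<and>
         generated_subalgebra {laurent_monom (upsilon c w j) | j. j \<in> {1..k}} \<subseteq> laurent_ring k"
proof -
  let ?a = "\<lambda>i. ray c n k i (w i)" and ?v = "upsilon c w"
  let ?R = "coordinate_ring k (dual_cone k (bott_cone c n k w))"
  let ?G = "generated_subalgebra {laurent_monom (?v j) | j. j \<in> {1..k}}"
  define M where "M = {m \<in> lattice_vecs k. \<forall>i\<in>{1..k}. 0 \<le> pairing k m (?a i)}"
  have R: "?R = laurent.span (laurent_monom ` M)"
    unfolding coordinate_ring_def M_def
    by (intro arg_cong[where f = "\<lambda>X. laurent.span (laurent_monom ` X)"] Collect_cong conj_cong refl
        real_of_lattice_in_dual_cone_iff)
  note dual = pairing_upsilon_ray[OF assms(1,3,4)]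
  have "laurent_monom m \<in> ?G" if m: "m \<in> M" for m
  proof -
    \<comment> \<open>Duality forces the coefficient of \<open>?v j\<close> to be the pairing of
      \<open>m\<close> with \<open>?a j\<close>; it is nonnegative because \<open>m \<in> M\<close>,
      so \<open>nat\<close> preserves it.\<close>
    define d where "d j = nat (pairing k m (?a j))" for j
    define s where "s = (\<Sum>j = 1..k. \<Sum>_<d j. ?v j)"
    \<comment> \<open>Both \<open>m\<close> and \<open>s\<close> have the same pairings with all
      rays, and these determine a lattice vector.\<close>
    have "m - s = 0"
    proof (rule lattice_vec_eq_0I[OF assms(1,3), where w = w])
      show "m - s \<in> lattice_vecs k"
        using m unfolding s_def M_def
        by (intro lattice_vecs_diff lattice_vecs_sum upsilon_in_lattice_vecs) auto
    next
      fix i assume i: "i \<in> {1..k}"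
      have "pairing k s (?a i) = (\<Sum>j = 1..k. int (d j) * (if i = j then 1 else 0))"
        unfolding s_def pairing_sum using i by (intro sum.cong) (auto simp: dual)
      also have "\<dots> = pairing k m (?a i)"
        using i m by (simp add: d_def M_def if_distrib cong: if_cong)
      finally show "pairing k (m - s) (?a i) = 0" by (simp add: pairing_diff)
    qed
    then have "m = s" by simp
    moreover have "laurent_monom s \<in> ?G"
      unfolding s_def
      by (intro laurent_monom_sum_nat_in_subalgebra is_subalgebra_generated)
        (auto simp: generated_subalgebra_def intro!: hull_inc)
    ultimately show ?thesis by simp
  qed
  then have "?R \<subseteq> ?G"
    unfolding R using is_subalgebra_generated
    by (intro laurent.span_minimal) (auto simp: is_subalgebra_def)
  \<comment> \<open>By duality the exponents of the generators pair to 0 or 1 with the rays, so they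
    lie in \<open>M\<close>; being an algebra, \<open>?R\<close> then contains all of
    \<open>?G\<close>.\<close>
  moreover have "?G \<subseteq> ?R"
    unfolding generated_subalgebra_def
  proof (rule hull_minimal)
    have "?v j \<in> M" if "j \<in> {1..k}" for j
      using that upsilon_in_lattice_vecs dual by (auto simp: M_def)
    then show "{laurent_monom (?v j) | j. j \<in> {1..k}} \<subseteq> ?R"
      unfolding R by (auto intro: laurent.span_base)
    show "is_subalgebra ?R"
      unfolding R by (rule is_subalgebra_span_monoms)
        (auto simp: M_def lattice_vecs_add pairing_add)
  qed
  \<comment> \<open>Shown for \<open>?R\<close>, where a spanning set is at hand; the equality just
    obtained carries it over to \<open>?G\<close>.\<close>
  moreover have "?R \<subseteq> laurent_ring k"
    unfolding R
  proof (rule laurent.span_minimal)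
    show "laurent_monom ` M \<subseteq> laurent_ring k"
      by (auto simp: M_def laurent_ring_def laurent_monom_def)
    show "laurent.subspace (laurent_ring k)"
    proof (rule laurent.subspaceI)
      fix f g assume "f \<in> laurent_ring k" "g \<in> laurent_ring k"
      then show "f + g \<in> laurent_ring k"
        using keys_add[of f g] by (auto simp: laurent_ring_def)
    qed (auto simp: laurent_ring_def in_keys_iff subset_iff)
  qed
  ultimately show ?thesis by auto
qed

end
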